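(* Let $u=u(x,y,t)$ be a solution of the dispersionless Kadomtsev--Petviashvili (dKP) equation $$(u_t-uu_x)_x=u_{yy}.$$ Then the metric and the one-form $$h=\mathrm{d}y^2-4\,\mathrm{d}x\,\mathrm{d}t-4u\,\mathrm{d}t^2,\qquad \nu=-4u_x\,\mathrm{d}t$$ give an Einstein--Weyl structure.
   Context: All objects are either smooth real or holomorphic, on an open set of a 3-dimensional space with coordinates $(x,y,t)$. Products such as $\mathrm{d}x\,\mathrm{d}t$ in a metric are symmetric products, so $h=\mathrm{d}y^2-4\mathrm{d}x\mathrm{d}t-4u\mathrm{d}t^2$ has components $h_{yy}=1$, $h_{xt}=h_{tx}=-2$, $h_{tt}=-4u$. A 3-dimensional Weyl structure is represented by a pair $(h,\nu)$ of a metric $h$ and a one-form $\nu$, with the torsion-free Weyl connection $D$ determined by $D_ih_{jk}=\nu_ih_{jk}$; pairs related by $h\to\phi^2h$, $\nu\to\nu+2\,\mathrm{d}\ln\phi$ represent the same Weyl structure. The structure is Einstein--Weyl if the symmetrised Ricci tensor of $D$ is proportional to $h$; in terms of the Levi-Civita connection $\nabla$, Ricci tensor $R_{ij}$ and scalar curvature $R$ of $h$ this is $$R_{ij}+\tfrac12\nabla_{(i}\nu_{j)}+\tfrac14\nu_i\nu_j-\tfrac13\Big(R+\tfrac12\nabla^k\nu_k+\tfrac14\nu^k\nu_k\Big)h_{ij}=0.$$ *)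

theory Defs
  imports "HOL-Analysis.Analysis"
begin

text \<open>
  The scalars \<^typ>\<open>'a::real_normed_field\<close> are the reals or the complex numbers. A point \<open>p\<close>
  of \<open>'a ^ 3\<close> has coordinates \<open>x = p $ 1\<close>, \<open>y = p $ 2\<close>, \<open>t = p $ 3\<close>.
\<close>

definition pd :: "3 \<Rightarrow> (('a::real_normed_field) ^ 3 \<Rightarrow> 'a) \<Rightarrow> 'a ^ 3 \<Rightarrow> 'a" where
  "pd i f p = deriv (\<lambda>s. f (p + s *s axis i 1)) 0"

text \<open>Both regularity notions below are meant for functions on an open set \<open>U\<close>.\<close>

fun Ck_on :: "nat \<Rightarrow> (real ^ 3) set \<Rightarrow> (real ^ 3 \<Rightarrow> real) \<Rightarrow> bool" where
  "Ck_on 0 U f \<longleftrightarrow> continuous_on U f"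
| "Ck_on (Suc k) U f \<longleftrightarrow> (\<forall>p\<in>U. f differentiable (at p)) \<and> (\<forall>i. Ck_on k U (pd i f))"

definition smooth3_on :: "(real ^ 3) set \<Rightarrow> (real ^ 3 \<Rightarrow> real) \<Rightarrow> bool" where
  "smooth3_on U f \<longleftrightarrow> (\<forall>k. Ck_on k U f)"

text \<open>Holomorphic in several variables: Frechet differentiable with complex-linear derivative.\<close>

definition holomorphic3_on :: "(complex ^ 3) set \<Rightarrow> (complex ^ 3 \<Rightarrow> complex) \<Rightarrow> bool" where
  "holomorphic3_on U f \<longleftrightarrow>
     (\<forall>p\<in>U. \<exists>f'. (f has_derivative f') (at p) \<and> (\<forall>c v. f' (c *s v) = c * f' v))"

text \<open>
  A metric is given by its matrix of components \<open>h p $ i $ j\<close>, a one-form by its components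
  \<open>\<nu> p $ i\<close>, and an affine connection by its coefficients \<open>\<Gamma> p k i j\<close>, standing for
  \<open>\<Gamma>\<^sup>k\<^bsub>ij\<^esub>\<close>, in the convention
  \<open>D\<^sub>i \<omega>\<^sub>j = \<partial>\<^sub>i \<omega>\<^sub>j - \<Gamma>\<^sup>k\<^bsub>ij\<^esub> \<omega>\<^sub>k\<close>.
\<close>

type_synonym 'a metric3 = "'a ^ 3 \<Rightarrow> 'a ^ 3 ^ 3"
type_synonym 'a form3 = "'a ^ 3 \<Rightarrow> 'a ^ 3"
type_synonym 'a connection3 = "'a ^ 3 \<Rightarrow> 3 \<Rightarrow> 3 \<Rightarrow> 3 \<Rightarrow> 'a"

definition cov_form ::
  "('a::real_normed_field) connection3 \<Rightarrow> 'a form3 \<Rightarrow> 'a ^ 3 \<Rightarrow> 3 \<Rightarrow> 3 \<Rightarrow> 'a" where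
  "cov_form \<Gamma> \<nu> p i j = pd i (\<lambda>q. \<nu> q $ j) p - (\<Sum>k\<in>UNIV. \<Gamma> p k i j * \<nu> p $ k)"

definition cov_metric ::
  "('a::real_normed_field) connection3 \<Rightarrow> 'a metric3 \<Rightarrow> 'a ^ 3 \<Rightarrow> 3 \<Rightarrow> 3 \<Rightarrow> 3 \<Rightarrow> 'a" where
  "cov_metric \<Gamma> h p i j k = pd i (\<lambda>q. h q $ j $ k) p
     - (\<Sum>l\<in>UNIV. \<Gamma> p l i j * h p $ l $ k) - (\<Sum>l\<in>UNIV. \<Gamma> p l i k * h p $ j $ l)"

text \<open>
  \<open>Ric\<^bsub>jk\<^esub> = \<partial>\<^sub>i \<Gamma>\<^sup>i\<^bsub>jk\<^esub> - \<partial>\<^sub>k \<Gamma>\<^sup>i\<^bsub>ij\<^esub>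
    + \<Gamma>\<^sup>i\<^bsub>il\<^esub> \<Gamma>\<^sup>l\<^bsub>jk\<^esub> - \<Gamma>\<^sup>i\<^bsub>kl\<^esub> \<Gamma>\<^sup>l\<^bsub>ij\<^esub>\<close>
  for a torsion-free connection; the sign makes round spheres positively curved.
\<close>

definition ricci :: "('a::real_normed_field) connection3 \<Rightarrow> 'a ^ 3 \<Rightarrow> 3 \<Rightarrow> 3 \<Rightarrow> 'a" where
  "ricci \<Gamma> p j k = (\<Sum>i\<in>UNIV. pd i (\<lambda>q. \<Gamma> q i j k) p - pd k (\<lambda>q. \<Gamma> q i i j) p
     + (\<Sum>l\<in>UNIV. \<Gamma> p i i l * \<Gamma> p l j k - \<Gamma> p i k l * \<Gamma> p l i j))"

text \<open>
  The regularity class \<open>reg\<close> is \<^const>\<open>smooth3_on\<close> or \<^const>\<open>holomorphic3_on\<close>. The pair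
  \<open>(h, \<nu>)\<close> is a representative of a Weyl structure; \<open>h\<close> may have any signature.
\<close>

definition weyl_pair ::
  "(('a::real_normed_field ^ 3) set \<Rightarrow> ('a ^ 3 \<Rightarrow> 'a) \<Rightarrow> bool) \<Rightarrow> ('a ^ 3) set
     \<Rightarrow> 'a metric3 \<Rightarrow> 'a form3 \<Rightarrow> bool" where
  "weyl_pair reg U h \<nu> \<longleftrightarrow> open U
     \<and> (\<forall>p\<in>U. transpose (h p) = h p \<and> invertible (h p))
     \<and> (\<forall>i j. reg U (\<lambda>p. h p $ i $ j)) \<and> (\<forall>i. reg U (\<lambda>p. \<nu> p $ i))"

text \<open>For a Weyl pair these conditions determine \<open>\<Gamma>\<close> uniquely on \<open>U\<close>.\<close>

definition weyl_connection ::
  "('a::real_normed_field ^ 3) set \<Rightarrow> 'a metric3 \<Rightarrow> 'a form3 \<Rightarrow> 'a connection3 \<Rightarrow> bool" where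
  "weyl_connection U h \<nu> \<Gamma> \<longleftrightarrow> (\<forall>p\<in>U. \<forall>i j k.
     \<Gamma> p k i j = \<Gamma> p k j i \<and> cov_metric \<Gamma> h p i j k = \<nu> p $ i * h p $ j $ k)"

definition einstein_weyl ::
  "(('a::real_normed_field ^ 3) set \<Rightarrow> ('a ^ 3 \<Rightarrow> 'a) \<Rightarrow> bool) \<Rightarrow> ('a ^ 3) set
     \<Rightarrow> 'a metric3 \<Rightarrow> 'a form3 \<Rightarrow> bool" where
  "einstein_weyl reg U h \<nu> \<longleftrightarrow> weyl_pair reg U h \<nu>
     \<and> (\<exists>\<Gamma>. weyl_connection U h \<nu> \<Gamma>
          \<and> (\<exists>\<Lambda>. \<forall>p\<in>U. \<forall>i j. (ricci \<Gamma> p i j + ricci \<Gamma> p j i) / 2 = \<Lambda> p * h p $ i $ j))"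

text \<open>The same condition expressed through the Levi-Civita connection of \<open>h\<close>.\<close>

definition levi_civita :: "('a::real_normed_field) metric3 \<Rightarrow> 'a connection3" where
  "levi_civita h p k i j = (\<Sum>l\<in>UNIV. matrix_inv (h p) $ k $ l *
     (pd i (\<lambda>q. h q $ j $ l) p + pd j (\<lambda>q. h q $ i $ l) p - pd l (\<lambda>q. h q $ i $ j) p)) / 2"

definition metric_trace ::
  "('a::real_normed_field) metric3 \<Rightarrow> 'a ^ 3 \<Rightarrow> (3 \<Rightarrow> 3 \<Rightarrow> 'a) \<Rightarrow> 'a" where
  "metric_trace h p T = (\<Sum>i\<in>UNIV. \<Sum>j\<in>UNIV. matrix_inv (h p) $ i $ j * T i j)"

definition einstein_weyl_equation ::
  "('a::real_normed_field ^ 3) set \<Rightarrow> 'a metric3 \<Rightarrow> 'a form3 \<Rightarrow> bool" where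
  "einstein_weyl_equation U h \<nu> \<longleftrightarrow> (\<forall>p\<in>U. \<forall>i j.
     (let Ric = ricci (levi_civita h) p;
          N = cov_form (levi_civita h) \<nu> p
      in Ric i j + 1/2 * ((N i j + N j i) / 2) + 1/4 * \<nu> p $ i * \<nu> p $ j
         - 1/3 * (metric_trace h p Ric + 1/2 * metric_trace h p N
                  + 1/4 * metric_trace h p (\<lambda>k l. \<nu> p $ k * \<nu> p $ l)) * h p $ i $ j = 0))"

definition dKP :: "('a::real_normed_field ^ 3) set \<Rightarrow> ('a ^ 3 \<Rightarrow> 'a) \<Rightarrow> bool" where
  "dKP U u \<longleftrightarrow>
     (\<forall>p\<in>U. pd 1 (\<lambda>q. pd 3 u q - u q * pd 1 u q) p = pd 2 (pd 2 u) p)"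

text \<open>
  \<open>dx dt\<close> is a symmetric product, so \<open>-4 dx dt\<close> contributes \<open>-2\<close> to each of the
  components \<open>xt\<close> and \<open>tx\<close>.
\<close>

definition dKP_metric :: "(('a::real_normed_field) ^ 3 \<Rightarrow> 'a) \<Rightarrow> 'a metric3" where
  "dKP_metric u p = vector [vector [ 0, 0, -2],
                            vector [ 0, 1,  0],
                            vector [-2, 0, -4 * u p]]"

definition dKP_form :: "(('a::real_normed_field) ^ 3 \<Rightarrow> 'a) \<Rightarrow> 'a form3" where
  "dKP_form u p = vector [0, 0, -4 * pd 1 u p]"

end

theory Submission
  imports Defs "HOL-Complex_Analysis.Complex_Analysis"
begin

text \<open>
  The Weyl connection of \<open>(h, \<nu>)\<close> is the Levi-Civita connection of \<open>h\<close> corrected by a term linear in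
  \<open>\<nu>\<close>, and for the dKP data its coefficients are short expressions in \<open>u\<close> and its first derivatives.
  Computing its Ricci tensor shows that the symmetrized part is \<open>u\<^sub>x\<^sub>x h\<close> in all components except
  possibly \<open>tt\<close>, and that the defect in the \<open>tt\<close> component is a multiple of
  \<open>u\<^sub>x\<^sub>t - u\<^sub>x\<^sup>2 - u u\<^sub>x\<^sub>x - u\<^sub>y\<^sub>y = (u\<^sub>t - u u\<^sub>x)\<^sub>x - u\<^sub>y\<^sub>y\<close>. It vanishes by the dKP equation. The form of the
  Einstein-Weyl condition that uses the Levi-Civita connection is checked from the same
  computation: both connections belong to the family \<open>dKP_connection c\<close>, with \<open>c = 1\<close> and \<open>c = 0\<close>,
  and \<open>ricci_dKP_connection\<close> treats all \<open>c\<close> at once.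

  The computation is purely algebraic once \<open>u\<close> and its first partial derivatives are differentiable
  over the scalar field and mixed second derivatives commute. The latter follows from the former over
  any normed field (\<open>pd_commute\<close>), so the locale \<open>dKP_solution\<close> handles real and complex scalars
  together. What separates the two cases is regularity. For smooth functions, differentiability of
  the partial derivatives is part of the definition. For holomorphic functions it is a theorem,
  \<open>holomorphic3_on_pd\<close>: by Cauchy's inequality on complex lines, difference quotients converge locally
  uniformly, and locally uniform limits of holomorphic functions are holomorphic.
\<close>

section \<open>Partial derivatives over a normed field\<close>

text \<open>
  \<^const>\<open>pd\<close> is total and says nothing where the derivative does not exist, so the calculus
  of partial derivatives is carried out with this relation, which includes existence.
\<close>

definition has_pd :: "3 \<Rightarrow> ('a::real_normed_field ^ 3 \<Rightarrow> 'a) \<Rightarrow> 'a \<Rightarrow> 'a ^ 3 \<Rightarrow> bool" where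
  "has_pd i f D p \<longleftrightarrow> ((\<lambda>s. f (p + s *s axis i 1)) has_field_derivative D) (at 0)"

lemma has_pd_imp_pd: "has_pd i f D p \<Longrightarrow> pd i f p = D"
  unfolding has_pd_def pd_def by (rule DERIV_imp_deriv)

lemma has_pd_const: "has_pd i (\<lambda>q. c) 0 p"
  unfolding has_pd_def by simp

lemma has_pd_add: "has_pd i f D p \<Longrightarrow> has_pd i g E p \<Longrightarrow> has_pd i (\<lambda>q. f q + g q) (D + E) p"
  unfolding has_pd_def by (rule DERIV_add)

lemma has_pd_diff: "has_pd i f D p \<Longrightarrow> has_pd i g E p \<Longrightarrow> has_pd i (\<lambda>q. f q - g q) (D - E) p"
  unfolding has_pd_def by (rule DERIV_diff)

lemma has_pd_mult:
  "has_pd i f D p \<Longrightarrow> has_pd i g E p \<Longrightarrow> has_pd i (\<lambda>q. f q * g q) (D * g p + f p * E) p"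
  unfolding has_pd_def by (auto intro!: derivative_eq_intros)

lemma has_pd_cmult: "has_pd i f D p \<Longrightarrow> has_pd i (\<lambda>q. c * f q) (c * D) p"
  unfolding has_pd_def by (rule DERIV_cmult)

lemma has_pd_along_line:
  assumes "has_pd i f D (p + s *s axis i 1)"
  shows "((\<lambda>t. f (p + t *s axis i 1)) has_field_derivative D) (at s)"
proof -
  have "((\<lambda>t. f (p + (t + s) *s axis i 1)) has_field_derivative D) (at 0)"
    using assms by (simp add: has_pd_def vector_sadd_rdistrib add_ac)
  then show ?thesis by (simp add: DERIV_shift[of _ _ 0 s, simplified])
qed

lemma norm_vector_smult: "norm (c *s v) = norm c * norm (v :: 'a::real_normed_field ^ 'n)"
  by (simp add: norm_vec_def L2_set_def norm_mult power_mult_distrib flip: sum_distrib_left)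
     (simp add: real_sqrt_mult)

lemma norm_axis_one: "norm (axis i 1 :: 'a::real_normed_field ^ 'n) = 1"
proof -
  have "(\<Sum>j\<in>UNIV. (norm ((axis i 1 :: 'a ^ 'n) $ j))\<^sup>2) = (\<Sum>j\<in>UNIV. if j = i then 1 else 0)"
    by (intro sum.cong) (auto simp: axis_def)
  then show ?thesis by (simp add: norm_vec_def L2_set_def)
qed

lemma bounded_linear_smult_left: "bounded_linear (\<lambda>s. s *s (v :: 'a::real_normed_field ^ 'n))"
  by (rule bounded_linear_intro[of _ "norm v"])
     (auto simp: vector_sadd_rdistrib norm_vector_smult vec_eq_iff)

lemma eventually_on_line:
  fixes p v :: "'a::real_normed_field ^ 3"
  assumes "open U" "p \<in> U"
  shows "\<forall>\<^sub>F s in nhds 0. p + s *s v \<in> U"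
proof -
  have "((\<lambda>s. p + s *s v) \<longlongrightarrow> p + 0 *s v) (nhds 0)"
    by (intro tendsto_add tendsto_const bounded_linear.tendsto[OF bounded_linear_smult_left] filterlim_ident)
  then show ?thesis using assms by (auto dest: topological_tendstoD)
qed

text \<open>
  On an open set a partial derivative depends only on the values there. This allows functions
  to be replaced by formulas that are valid on \<open>U\<close> only.
\<close>

lemma pd_cong:
  assumes "open U" "p \<in> U" "\<And>q. q \<in> U \<Longrightarrow> f q = g q"
  shows "pd i f p = pd i g p"
  unfolding pd_def
  by (rule deriv_cong_ev[OF eventually_mono[OF eventually_on_line[OF assms(1,2), of "axis i 1"]]])
     (simp_all add: assms(3))

text \<open>
  Differentiability over the scalar field. For complex scalars it is complex
  differentiability at a point and for real scalars ordinary Frechet differentiability, so that the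
  arguments below serve both cases.
\<close>

definition scalar_differentiable :: "('a::real_normed_field ^ 3 \<Rightarrow> 'a) \<Rightarrow> 'a ^ 3 \<Rightarrow> bool" where
  "scalar_differentiable f p \<longleftrightarrow>
     (\<exists>f'. (f has_derivative f') (at p) \<and> (\<forall>c v. f' (c *s v) = c * f' v))"

lemma has_derivative_along_line:
  fixes f :: "'a::real_normed_field ^ 3 \<Rightarrow> 'a"
  assumes "(f has_derivative f') (at (p + s *s v))" "\<And>c w. f' (c *s w) = c * f' w"
  shows "((\<lambda>t. f (p + t *s v)) has_field_derivative f' v) (at s)"
proof -
  have "((\<lambda>t. p + t *s v) has_derivative (\<lambda>t. 0 + t *s v)) (at s)"
    by (intro has_derivative_add has_derivative_const
        bounded_linear_imp_has_derivative[OF bounded_linear_smult_left])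
  from has_derivative_compose[OF this assms(1)]
  have "((\<lambda>t. f (p + t *s v)) has_derivative (\<lambda>t. f' (t *s v))) (at s)" by simp
  moreover have "(\<lambda>t. f' (t *s v)) = (*) (f' v)"
    by (simp add: fun_eq_iff assms(2) mult.commute)
  ultimately show ?thesis by (simp only: has_field_derivative_def)
qed

lemma has_derivative_imp_has_pd:
  assumes "(f has_derivative f') (at p)" "\<And>c w. f' (c *s w) = c * f' w"
  shows "has_pd i f (f' (axis i 1)) p"
  unfolding has_pd_def using assms by (intro has_derivative_along_line) auto

lemma scalar_differentiable_has_pd:
  "scalar_differentiable f p \<Longrightarrow> has_pd i f (pd i f p) p"
  using has_derivative_imp_has_pd has_pd_imp_pd unfolding scalar_differentiable_def by metis

section \<open>Symmetry of second partial derivatives\<close>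

text \<open>
  The mean value inequality is applied on \<open>\<bar>t\<bar> \<le> \<bar>h\<bar>\<close> to the function of \<open>t\<close> given by
  \<open>u (p + h e\<^sub>i + t e\<^sub>j) - u (p + t e\<^sub>j) - t h \<partial>\<^sub>i\<partial>\<^sub>j u\<close>, whose derivative is \<open>o(h)\<close> because
  \<open>\<partial>\<^sub>j u\<close> is differentiable at \<open>p\<close>. Its increment from \<open>0\<close> to \<open>h\<close> is the second difference minus
  \<open>h\<^sup>2 \<partial>\<^sub>i\<partial>\<^sub>j u\<close>. Only the inequality form of the mean value theorem enters, so the scalars may be
  complex.
\<close>

lemma mixed_second_difference:
  fixes u :: "'a::real_normed_field ^ 3 \<Rightarrow> 'a"
  assumes "open U" "p \<in> U" and u: "\<And>q. q \<in> U \<Longrightarrow> has_pd j u (pd j u q) q"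
    and v: "scalar_differentiable (pd j u) p" and "e > 0"
  shows "\<exists>d>0. \<forall>h. norm h < d \<longrightarrow>
           norm (u (p + h *s axis i 1 + h *s axis j 1) - u (p + h *s axis i 1)
                 - u (p + h *s axis j 1) + u p - h * h * pd i (pd j u) p) \<le> e * (norm h)\<^sup>2"
proof -
  let ?a = "axis i (1::'a) :: 'a ^ 3" and ?b = "axis j (1::'a) :: 'a ^ 3"
  obtain L where L: "(pd j u has_derivative L) (at p)" and lin: "\<And>c w. L (c *s w) = c * L w"
    using v unfolding scalar_differentiable_def by auto
  have La: "L ?a = pd i (pd j u) p"
    using has_pd_imp_pd[OF has_derivative_imp_has_pd[OF L lin]] by simp
  obtain d1 where d1: "d1 > 0" "ball p d1 \<subseteq> U"
    using assms(1,2) open_contains_ball by blast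
  obtain d2 where d2: "d2 > 0" and
    dL: "\<And>y. norm (y - p) < d2 \<Longrightarrow> norm (pd j u y - pd j u p - L (y - p)) \<le> e/3 * norm (y - p)"
    using L[unfolded has_derivative_at_alt, THEN conjunct2, rule_format, of "e/3"] \<open>e > 0\<close> by auto
  have inU: "p + w \<in> U" if "norm w < d1" for w
    using that by (intro subsetD[OF d1(2)]) (simp add: dist_norm)
  \<comment> \<open>The increment \<open>h e\<^sub>i + t e\<^sub>j\<close> has norm at most \<open>2 \<bar>h\<bar>\<close>, hence the factor \<open>1/2\<close>; the errors at its
    two ends add up to at most \<open>(e/3) (2 \<bar>h\<bar>) + (e/3) \<bar>h\<bar>\<close>, hence the \<open>e/3\<close> above.\<close>
  define d where "d = min d1 d2 / 2"
  have "norm (u (p + h *s ?a + h *s ?b) - u (p + h *s ?a) - u (p + h *s ?b) + u p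
          - h * h * pd i (pd j u) p) \<le> e * (norm h)\<^sup>2" if h: "norm h < d" for h
  proof -
    define G where "G t = u (p + h *s ?a + t *s ?b) - u (p + t *s ?b) - t * (h * L ?a)" for t
    define G' where "G' t = pd j u (p + h *s ?a + t *s ?b) - pd j u (p + t *s ?b) - h * L ?a" for t
    have small: "norm (h *s ?a + t *s ?b) \<le> 2 * norm h" "norm (t *s ?b) \<le> norm h"
      if "t \<in> cball 0 (norm h)" for t
      using that norm_triangle_ineq[of "h *s ?a" "t *s ?b"]
      by (auto simp: norm_vector_smult norm_axis_one)
    have "norm (G h - G 0) \<le> (e * norm h) * norm (h - 0)"
    proof (rule field_differentiable_bound[of "cball 0 (norm h)" G G'])
      fix t :: 'a assume t: "t \<in> cball 0 (norm h)"
      have U1: "p + h *s ?a + t *s ?b \<in> U" and U2: "p + t *s ?b \<in> U"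
        using inU[of "h *s ?a + t *s ?b"] inU[of "t *s ?b"] small[OF t] h norm_ge_zero[of h]
        by (auto simp: d_def add.assoc simp del: norm_ge_zero)
      show "(G has_field_derivative G' t) (at t within cball 0 (norm h))"
        unfolding G_def G'_def
        by (rule has_field_derivative_at_within)
           (auto intro!: derivative_eq_intros has_pd_along_line[OF u[OF U1]] has_pd_along_line[OF u[OF U2]])
      let ?R = "\<lambda>w. pd j u (p + w) - pd j u p - L w"
      have R: "norm (?R w) \<le> e/3 * norm w" if "norm w < d2" for w
        using dL[of "p + w"] that by simp
      have "L (h *s ?a + t *s ?b) = h * L ?a + L (t *s ?b)"
        by (simp add: lin linear_add[OF has_derivative_linear[OF L]])
      then have "G' t = ?R (h *s ?a + t *s ?b) - ?R (t *s ?b)"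
        by (simp add: G'_def add.assoc)
      also have "norm \<dots> \<le> e/3 * norm (h *s ?a + t *s ?b) + e/3 * norm (t *s ?b)"
        using small[OF t] h norm_ge_zero[of h]
        by (intro order_trans[OF norm_triangle_ineq4 add_mono] R)
           (auto simp: d_def simp del: norm_ge_zero)
      also have "\<dots> \<le> e/3 * (2 * norm h) + e/3 * norm h"
        using small[OF t] \<open>e > 0\<close> by (intro add_mono mult_left_mono) auto
      finally show "norm (G' t) \<le> e * norm h" by simp
    qed auto
    moreover have "G h - G 0 = u (p + h *s ?a + h *s ?b) - u (p + h *s ?a) - u (p + h *s ?b) + u p
        - h * h * pd i (pd j u) p"
      by (simp add: G_def La algebra_simps)
    ultimately show ?thesis by (simp add: power2_eq_square mult.assoc)
  qed
  moreover have "d > 0" using d1 d2 by (simp add: d_def)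
  ultimately show ?thesis by blast
qed

text \<open>
  The second difference does not change when \<open>i\<close> and \<open>j\<close> are exchanged, and divided by \<open>h\<^sup>2\<close> it
  tends to both mixed derivatives.
\<close>

lemma pd_commute:
  fixes u :: "'a::real_normed_field ^ 3 \<Rightarrow> 'a"
  assumes "open U" "p \<in> U" and u: "\<And>q k. q \<in> U \<Longrightarrow> has_pd k u (pd k u q) q"
    and v: "\<And>k. scalar_differentiable (pd k u) p"
  shows "pd i (pd j u) p = pd j (pd i u) p"
proof -
  let ?A = "pd i (pd j u) p" and ?B = "pd j (pd i u) p"
  have "norm (?A - ?B) \<le> 0 + e" if "e > 0" for e
  proof -
    have e2: "e / 2 > 0" using that by simp
    define E where "E a b h = norm (u (p + h *s axis a 1 + h *s axis b 1)
      - u (p + h *s axis a 1) - u (p + h *s axis b 1) + u p - h * h * pd a (pd b u) p)" for a b h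
    have D: "\<exists>d>0. \<forall>h. norm h < d \<longrightarrow> E a b h \<le> e/2 * (norm h)\<^sup>2" for a b
      unfolding E_def by (rule mixed_second_difference[OF assms(1,2) u v e2])
    obtain d1 where d1: "d1 > 0" "\<And>h. norm h < d1 \<Longrightarrow> E i j h \<le> e/2 * (norm h)\<^sup>2"
      using D[of i j] by blast
    obtain d2 where d2: "d2 > 0" "\<And>h. norm h < d2 \<Longrightarrow> E j i h \<le> e/2 * (norm h)\<^sup>2"
      using D[of j i] by blast
    define h :: 'a where "h = of_real (min d1 d2 / 2)"
    have h: "norm h < d1" "norm h < d2" "norm h > 0"
      using d1(1) d2(1) by (auto simp: h_def)
    let ?D = "u (p + h *s axis i 1 + h *s axis j 1) - u (p + h *s axis i 1)
             - u (p + h *s axis j 1) + u p"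
    have "norm (h * h * ?A - h * h * ?B) = norm ((?D - h * h * ?B) - (?D - h * h * ?A))" by simp
    also have "\<dots> \<le> e/2 * (norm h)\<^sup>2 + e/2 * (norm h)\<^sup>2"
      using d1(2)[OF h(1)] d2(2)[OF h(2)] unfolding E_def
      by (intro order_trans[OF norm_triangle_ineq4 add_mono]) (simp_all add: algebra_simps)
    also have "\<dots> = (norm h)\<^sup>2 * e" by simp
    finally have "(norm h)\<^sup>2 * norm (?A - ?B) \<le> (norm h)\<^sup>2 * e"
      by (simp add: norm_mult power2_eq_square flip: right_diff_distrib)
    then show ?thesis using h(3) by simp
  qed
  then have "norm (?A - ?B) \<le> 0" by (rule field_le_epsilon)
  then show ?thesis by simp
qed

section \<open>The dKP metric, its connections and their curvature\<close>

text \<open>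
  The torsion-free connection \<open>\<Gamma>\<close> with \<open>D\<^sub>i h\<^sub>j\<^sub>k = c \<nu>\<^sub>i h\<^sub>j\<^sub>k\<close>, that is, the Weyl connection of \<open>(h, c \<nu>)\<close>; the three
  matrices are \<open>\<Gamma>\<^sup>x\<close>, \<open>\<Gamma>\<^sup>y\<close> and \<open>\<Gamma>\<^sup>t\<close>. The parameter makes one curvature computation serve twice:
  \<open>c = 0\<close> is the Levi-Civita connection of \<open>h\<close> and \<open>c = 1\<close> the Weyl connection of \<open>(h, \<nu>)\<close>. In
  general \<open>\<Gamma>\<^sup>k\<^sub>i\<^sub>j\<close> is the Christoffel symbol of \<open>h\<close> minus
  \<open>(c/2) (\<delta>\<^sup>k\<^sub>i \<nu>\<^sub>j + \<delta>\<^sup>k\<^sub>j \<nu>\<^sub>i - h\<^sub>i\<^sub>j \<nu>\<^sup>k)\<close>, where \<open>\<nu>\<^sup>k\<close> has \<open>2 u\<^sub>x\<close> as its only nonzero component, \<open>\<nu>\<^sup>x\<close>.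
\<close>

definition dKP_connection :: "'a \<Rightarrow> ('a::real_normed_field ^ 3 \<Rightarrow> 'a) \<Rightarrow> 'a connection3" where
  "dKP_connection c u p k i j =
     (if k = 1 then vector [vector [0, 0, pd 1 u p],
                            vector [0, c * pd 1 u p, pd 2 u p],
                            vector [pd 1 u p, pd 2 u p, pd 3 u p + (2 - 4 * c) * (u p * pd 1 u p)]]
      else if k = 2 then vector [vector [0, 0, 0],
                                 vector [0, 0, 2 * c * pd 1 u p],
                                 vector [0, 2 * c * pd 1 u p, 2 * pd 2 u p]]
      else vector [vector [0, 0, 0],
                   vector [0, 0, 0],
                   vector [0, 0, (4 * c - 1) * pd 1 u p]] :: 'a ^ 3 ^ 3) $ i $ j"

lemma matrix_inv_eqI:
  fixes A B :: "'a::semiring_1 ^ 'n ^ 'n"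
  assumes "A ** B = mat 1" "B ** A = mat 1"
  shows "matrix_inv A = B"
proof -
  have "A ** matrix_inv A = mat 1 \<and> matrix_inv A ** A = mat 1"
    unfolding matrix_inv_def by (rule someI[of _ B]) (use assms in simp)
  then show ?thesis
    by (metis assms(2) matrix_mul_assoc matrix_mul_lid matrix_mul_rid)
qed

definition dKP_cometric :: "('a::real_normed_field ^ 3 \<Rightarrow> 'a) \<Rightarrow> 'a metric3" where
  "dKP_cometric u p = vector [vector [ u p,  0, -1/2],
                              vector [   0,  1,    0],
                              vector [-1/2,  0,    0]]"

lemma dKP_metric_mult_cometric:
  "dKP_metric u p ** dKP_cometric u p = mat 1" "dKP_cometric u p ** dKP_metric u p = mat 1"
  by (simp_all add: vec_eq_iff forall_3 matrix_matrix_mult_def sum_3 dKP_metric_def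
      dKP_cometric_def mat_def)

lemma matrix_inv_dKP_metric: "matrix_inv (dKP_metric u p) = dKP_cometric u p"
  using dKP_metric_mult_cometric by (intro matrix_inv_eqI)

lemma metric_trace_dKP:
  "metric_trace (dKP_metric u) p T = u p * T 1 1 - (T 1 3 + T 3 1) / 2 + T 2 2"
  by (simp add: metric_trace_def matrix_inv_dKP_metric dKP_cometric_def sum_3 field_simps)

lemma weyl_pair_dKP:
  assumes "open U" "\<And>c. reg U (\<lambda>p. c)" "reg U (\<lambda>p. - 4 * u p)" "reg U (\<lambda>p. - 4 * pd 1 u p)"
  shows "weyl_pair reg U (dKP_metric u) (dKP_form u)"
proof -
  have "transpose (dKP_metric u p) = dKP_metric u p" for p
    by (simp add: vec_eq_iff forall_3 transpose_def dKP_metric_def)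
  moreover have "invertible (dKP_metric u p)" for p
    using dKP_metric_mult_cometric unfolding invertible_def by blast
  moreover have "reg U (\<lambda>p. dKP_metric u p $ i $ j)" for i j
    using exhaust_3[of i] exhaust_3[of j] assms(2,3)
    by (elim disjE; simp add: dKP_metric_def)
  moreover have "reg U (\<lambda>p. dKP_form u p $ i)" for i
    using exhaust_3[of i] assms(2,4)
    by (elim disjE; simp add: dKP_form_def)
  ultimately show ?thesis using assms(1) by (simp add: weyl_pair_def)
qed

lemma ricci_cong:
  assumes "open U" "p \<in> U" "\<And>q k i j. q \<in> U \<Longrightarrow> \<Gamma> q k i j = \<Gamma>' q k i j"
  shows "ricci \<Gamma> p i j = ricci \<Gamma>' p i j"
  unfolding ricci_def
  by (intro sum.cong arg_cong2[of _ _ _ _ "(+)"] arg_cong2[of _ _ _ _ "(-)"]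
      pd_cong[OF assms(1,2)] refl) (simp_all add: assms)

text \<open>
  The common core of the real and the complex case: the curvature computation uses two orders of
  differentiability over the scalar field.
\<close>

locale dKP_solution =
  fixes U :: "('a::real_normed_field ^ 3) set" and u :: "'a ^ 3 \<Rightarrow> 'a"
  assumes open_U: "open U"
    and differentiable: "\<And>p. p \<in> U \<Longrightarrow> scalar_differentiable u p"
    and pd_differentiable: "\<And>p i. p \<in> U \<Longrightarrow> scalar_differentiable (pd i u) p"
    and dKP: "dKP U u"
begin

lemma has_pd_u: "p \<in> U \<Longrightarrow> has_pd i u (pd i u p) p"
  by (rule scalar_differentiable_has_pd[OF differentiable])

lemma has_pd_pd: "p \<in> U \<Longrightarrow> has_pd i (pd j u) (pd i (pd j u) p) p"
  by (rule scalar_differentiable_has_pd[OF pd_differentiable])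

lemma commute: "p \<in> U \<Longrightarrow> pd i (pd j u) p = pd j (pd i u) p"
  by (rule pd_commute[OF open_U _ has_pd_u pd_differentiable])

text \<open>
  These shapes cover every component of \<open>h\<close>, \<open>\<nu>\<close> and \<^const>\<open>dKP_connection\<close>. The rules with a minus
  sign are there because \<open>- 4 * f q\<close> has the simplifier normal form \<open>- (4 * f q)\<close>.
\<close>

lemma pd_simps:
  assumes "p \<in> U"
  shows "pd l (\<lambda>q. k) p = (0 :: 'a)"
    and "pd l (\<lambda>q. - (k * u q)) p = - (k * pd l u p)"
    and "pd l (\<lambda>q. k * pd j u q) p = k * pd l (pd j u) p"
    and "pd l (\<lambda>q. - (k * pd j u q)) p = - (k * pd l (pd j u) p)"
    and "pd l (\<lambda>q. pd j u q + k * (u q * pd m u q)) p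
       = pd l (pd j u) p + k * (pd l u p * pd m u p + u p * pd l (pd m u) p)"
  using has_pd_cmult[OF has_pd_u[OF assms], of l "- k"] has_pd_cmult[OF has_pd_pd[OF assms], of l "- k" j]
    has_pd_add[OF has_pd_pd[OF assms, of l j]
      has_pd_cmult[OF has_pd_mult[OF has_pd_u[OF assms] has_pd_pd[OF assms, of l m]], of k]]
  by (auto intro!: has_pd_imp_pd intro: has_pd_const has_pd_cmult has_pd_u has_pd_pd assms)

lemma dKP_expanded:
  assumes "p \<in> U"
  shows "pd 1 (pd 3 u) p = (pd 1 u p)\<^sup>2 + u p * pd 1 (pd 1 u) p + pd 2 (pd 2 u) p"
proof -
  have "pd 1 (\<lambda>q. pd 3 u q - u q * pd 1 u q) p
      = pd 1 (pd 3 u) p - (pd 1 u p * pd 1 u p + u p * pd 1 (pd 1 u) p)"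
    using assms by (intro has_pd_imp_pd has_pd_diff has_pd_mult has_pd_u has_pd_pd)
  then show ?thesis
    using dKP assms by (simp add: dKP_def power2_eq_square algebra_simps)
qed

text \<open>
  The determinant of \<open>h\<close> is constant, so the trace \<open>\<Gamma>\<^sup>i\<^sub>i\<^sub>j\<close> comes from the Weyl correction alone. It is
  \<open>- (3/2) c \<nu>\<^sub>j\<close>, with \<open>6 c u\<^sub>x\<close> for \<open>j = t\<close>, and its derivatives produce the skew part of the Ricci
  tensor. The dKP equation enters only afterwards, through the last diagonal entry.
\<close>

lemma ricci_dKP_connection:
  assumes "p \<in> U"
  shows "ricci (dKP_connection c u) p i j =
    (vector [vector [0, 0, pd 1 (pd 1 u) p],
             vector [0, c * pd 1 (pd 1 u) p, (1 + 2 * c) * pd 1 (pd 2 u) p],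
             vector [(1 - 6 * c) * pd 1 (pd 1 u) p, (1 - 4 * c) * pd 1 (pd 2 u) p,
               (2 - 4 * c) * u p * pd 1 (pd 1 u) p + 2 * pd 2 (pd 2 u) p
               - 2 * c * pd 1 (pd 3 u) p + (4 * c\<^sup>2 - 2 * c) * (pd 1 u p)\<^sup>2]] :: 'a ^ 3 ^ 3) $ i $ j"
proof -
  note [simp] = commute[OF assms, of 2 1] commute[OF assms, of 3 1]
  show ?thesis
    using exhaust_3[of i] exhaust_3[of j]
    by (elim disjE; simp add: ricci_def sum_3 dKP_connection_def pd_simps[OF assms])
       (simp_all add: power2_eq_square algebra_simps)
qed

lemma pd_dKP_metric:
  assumes "p \<in> U"
  shows "pd l (\<lambda>q. dKP_metric u q $ i $ j) p = (if i = 3 \<and> j = 3 then - 4 * pd l u p else 0)"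
  using exhaust_3[of i] exhaust_3[of j]
  by (elim disjE; simp add: dKP_metric_def pd_simps[OF assms])

lemma levi_civita_dKP_metric:
  assumes "p \<in> U"
  shows "levi_civita (dKP_metric u) p k i j = dKP_connection 0 u p k i j"
  unfolding levi_civita_def sum_3 matrix_inv_dKP_metric pd_dKP_metric[OF assms]
  using exhaust_3[of i] exhaust_3[of j] exhaust_3[of k]
  by (elim disjE; simp add: dKP_cometric_def dKP_connection_def)

lemma weyl_connection_dKP: "weyl_connection U (dKP_metric u) (dKP_form u) (dKP_connection 1 u)"
  unfolding weyl_connection_def
proof (intro ballI allI)
  fix p i j k assume p: "p \<in> U"
  show "dKP_connection 1 u p k i j = dKP_connection 1 u p k j i \<and>
      cov_metric (dKP_connection 1 u) (dKP_metric u) p i j k = dKP_form u p $ i * dKP_metric u p $ j $ k"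
    unfolding cov_metric_def sum_3 pd_dKP_metric[OF p]
    using exhaust_3[of i] exhaust_3[of j] exhaust_3[of k]
    by (elim disjE; simp add: dKP_metric_def dKP_form_def dKP_connection_def)
qed

text \<open>
  For \<open>c = 1\<close> the mixed terms in \<open>u\<^sub>x\<^sub>y\<close> cancel, and the \<open>xt\<close> and \<open>yy\<close> components force the factor
  \<open>u\<^sub>x\<^sub>x\<close>. The \<open>tt\<close> component is then \<open>-4 u u\<^sub>x\<^sub>x\<close> minus twice
  \<open>u\<^sub>x\<^sub>t - u\<^sub>x\<^sup>2 - u u\<^sub>x\<^sub>x - u\<^sub>y\<^sub>y\<close>, so it has the required form by the dKP equation.
\<close>

lemma symmetrized_ricci_dKP:
  assumes "p \<in> U"
  shows "(ricci (dKP_connection 1 u) p i j + ricci (dKP_connection 1 u) p j i) / 2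
       = pd 1 (pd 1 u) p * dKP_metric u p $ i $ j"
  using exhaust_3[of i] exhaust_3[of j]
  by (elim disjE; simp add: ricci_dKP_connection[OF assms] dKP_metric_def dKP_expanded[OF assms]
      algebra_simps)

lemma einstein_weyl_dKP:
  assumes "weyl_pair reg U (dKP_metric u) (dKP_form u)"
  shows "einstein_weyl reg U (dKP_metric u) (dKP_form u)"
  unfolding einstein_weyl_def
  using assms weyl_connection_dKP symmetrized_ricci_dKP by blast

lemma cov_form_dKP_form:
  assumes "p \<in> U"
  shows "cov_form (levi_civita (dKP_metric u)) (dKP_form u) p i j =
    (if j = 3 then - 4 * pd i (pd 1 u) p - (if i = 3 then 4 * (pd 1 u p)\<^sup>2 else 0) else 0)"
proof -
  have "pd i (\<lambda>q. dKP_form u q $ j) p = (if j = 3 then - 4 * pd i (pd 1 u) p else 0)"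
    using exhaust_3[of j]
    by (elim disjE; simp add: dKP_form_def pd_simps[OF assms])
  then show ?thesis
    unfolding cov_form_def sum_3 levi_civita_dKP_metric[OF assms]
    using exhaust_3[of i] exhaust_3[of j]
    by (elim disjE; simp add: dKP_form_def dKP_connection_def power2_eq_square)
qed

text \<open>
  For \<open>c = 0\<close> the tensor \<open>R\<^sub>i\<^sub>j + 1/2 \<nabla>\<^sub>(\<^sub>i \<nu>\<^sub>j\<^sub>) + 1/4 \<nu>\<^sub>i \<nu>\<^sub>j\<close> has only the \<open>tt\<close> component, because the
  terms in \<open>u\<^sub>x\<^sub>x\<close> and \<open>u\<^sub>x\<^sub>y\<close> cancel elsewhere. That component is
  \<open>- 2 (u\<^sub>x\<^sub>t - u\<^sub>x\<^sup>2 - u u\<^sub>x\<^sub>x - u\<^sub>y\<^sub>y)\<close>, which is zero by the dKP equation, and the trace vanishes since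
  \<open>h\<^sup>t\<^sup>t = 0\<close>.
\<close>

lemma einstein_weyl_equation_dKP: "einstein_weyl_equation U (dKP_metric u) (dKP_form u)"
  unfolding einstein_weyl_equation_def Let_def
proof (intro ballI allI, goal_cases)
  case (1 p i j)
  note p = \<open>p \<in> U\<close>
  have Ric: "ricci (levi_civita (dKP_metric u)) p a b = ricci (dKP_connection 0 u) p a b" for a b
    using open_U p levi_civita_dKP_metric by (rule ricci_cong)
  note [simp] = commute[OF p, of 2 1] commute[OF p, of 3 1]
  show ?case
    unfolding metric_trace_dKP cov_form_dKP_form[OF p] Ric ricci_dKP_connection[OF p]
    using exhaust_3[of i] exhaust_3[of j]
    by (elim disjE; simp add: dKP_metric_def dKP_form_def dKP_expanded[OF p])
       (simp_all add: power2_eq_square field_simps)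
qed

end

section \<open>Smooth functions\<close>

lemma Ck_on_cong:
  assumes "open U" "\<And>p. p \<in> U \<Longrightarrow> f p = g p"
  shows "Ck_on k U f \<longleftrightarrow> Ck_on k U g"
  using assms(2)
proof (induction k arbitrary: f g)
  case 0
  then show ?case by (simp cong: continuous_on_cong)
next
  case (Suc k)
  have imp: "b differentiable at p"
    if "a differentiable at p" "p \<in> U" "\<And>q. q \<in> U \<Longrightarrow> a q = b q" for a b :: "real ^ 3 \<Rightarrow> real" and p
    using that has_derivative_transform_within_open[of a _ p UNIV U b] assms(1)
    unfolding differentiable_def by blast
  have "Ck_on k U (pd i f) \<longleftrightarrow> Ck_on k U (pd i g)" for i
    using pd_cong[OF assms(1) _ Suc.prems] by (rule Suc.IH)
  moreover have "f differentiable at p \<longleftrightarrow> g differentiable at p" if "p \<in> U" for p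
    using imp[of f p g] imp[of g p f] that Suc.prems by auto
  ultimately show ?case by simp
qed

lemma real_scalar_differentiable_iff:
  "scalar_differentiable f p \<longleftrightarrow> f differentiable at (p :: real ^ 3)"
  unfolding scalar_differentiable_def differentiable_def
  by (auto simp: scalar_mult_eq_scaleR linear_scale[OF has_derivative_linear])

lemma smooth3_on_const: "smooth3_on U (\<lambda>p. c)"
proof -
  have "Ck_on k U (\<lambda>p. c)" for k
  proof (induction k arbitrary: c)
    case (Suc k)
    have "pd i (\<lambda>p. c) = (\<lambda>p :: real ^ 3. 0)" for i
      using has_pd_imp_pd[OF has_pd_const] by blast
    then show ?case by (simp add: Suc.IH)
  qed simp
  then show ?thesis by (simp add: smooth3_on_def)
qed

lemma smooth3_on_cmult:
  assumes "open U" "smooth3_on U f"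
  shows "smooth3_on U (\<lambda>p. c * f p)"
proof -
  have "Ck_on k U (\<lambda>p. c * f p)" if "Ck_on k U f" for k
    using that
  proof (induction k arbitrary: f)
    case 0
    then show ?case by (simp add: continuous_on_mult_left)
  next
    case (Suc k)
    have "Ck_on k U (pd i (\<lambda>p. c * f p)) \<longleftrightarrow> Ck_on k U (\<lambda>p. c * pd i f p)" for i
      by (rule Ck_on_cong[OF assms(1)], rule has_pd_imp_pd, rule has_pd_cmult,
          rule scalar_differentiable_has_pd)
         (use Suc.prems in \<open>simp add: real_scalar_differentiable_iff\<close>)
    then show ?case using Suc by (simp add: differentiable_cmult_left_iff differentiable_mult)
  qed
  then show ?thesis using assms(2) by (simp add: smooth3_on_def)
qed

lemma smooth3_on_pd: "smooth3_on U f \<Longrightarrow> smooth3_on U (pd i f)"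
  unfolding smooth3_on_def by (metis Ck_on.simps(2))

lemma smooth3_on_scalar_differentiable:
  assumes "smooth3_on U f" "p \<in> U"
  shows "scalar_differentiable f p"
  using assms Ck_on.simps(2)[of 0 U f] by (simp add: smooth3_on_def real_scalar_differentiable_iff del: Ck_on.simps)

section \<open>Holomorphic functions of several variables\<close>

lemma holomorphic3_on_iff: "holomorphic3_on U f \<longleftrightarrow> (\<forall>p\<in>U. scalar_differentiable f p)"
  by (simp add: holomorphic3_on_def scalar_differentiable_def)

lemma holomorphic3_on_const: "holomorphic3_on U (\<lambda>p. c)"
  unfolding holomorphic3_on_def by (auto intro!: exI[of _ "\<lambda>_. 0"])

lemma holomorphic3_on_cmult:
  assumes "holomorphic3_on U f"
  shows "holomorphic3_on U (\<lambda>p. c * f p)"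
  unfolding holomorphic3_on_def
proof
  fix p assume "p \<in> U"
  then obtain f' where "(f has_derivative f') (at p)" "\<And>a v. f' (a *s v) = a * f' v"
    using assms unfolding holomorphic3_on_def by blast
  then show "\<exists>f'. ((\<lambda>p. c * f p) has_derivative f') (at p) \<and> (\<forall>a v. f' (a *s v) = a * f' v)"
    by (intro exI[of _ "\<lambda>v. c * f' v"]) (auto intro: has_derivative_mult_right)
qed

text \<open>
  The one-variable Cauchy inequality on the complex line through \<open>x\<close> in direction \<open>v\<close>, on which the
  ball of radius \<open>r\<close> cuts out the disc of radius \<open>r / \<bar>v\<bar>\<close>.
\<close>

lemma directional_Cauchy_estimate:
  fixes f :: "complex ^ 3 \<Rightarrow> complex"
  assumes hol: "holomorphic3_on U f" and r: "r > 0" "cball x r \<subseteq> U"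
    and B: "\<And>y. y \<in> cball x r \<Longrightarrow> norm (f y) \<le> B"
    and f': "(f has_derivative f') (at x)" "\<And>c v. f' (c *s v) = c * f' v"
  shows "norm (f' v) \<le> B / r * norm v"
proof (cases "v = 0")
  case True
  then show ?thesis using f'(2)[of 0 0] by simp
next
  case False
  define \<rho> where "\<rho> = r / norm v"
  have \<rho>: "\<rho> > 0" using r False by (simp add: \<rho>_def)
  have in_ball: "x + z *s v \<in> cball x r" if "z \<in> cball 0 \<rho>" for z
    using that False by (simp add: dist_norm norm_vector_smult \<rho>_def field_simps)
  have diff: "(\<lambda>z. f (x + z *s v)) field_differentiable (at z)" if "z \<in> cball 0 \<rho>" for z
    using hol r(2) in_ball[OF that] has_derivative_along_line
    unfolding holomorphic3_on_def field_differentiable_def by blast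
  have hol': "(\<lambda>z. f (x + z *s v)) holomorphic_on cball 0 \<rho>"
    unfolding holomorphic_on_def using diff field_differentiable_at_within by blast
  have "norm ((deriv ^^ 1) (\<lambda>z. f (x + z *s v)) 0) \<le> fact 1 * B / \<rho> ^ 1"
  proof (rule Cauchy_inequality)
    show "(\<lambda>z. f (x + z *s v)) holomorphic_on ball 0 \<rho>"
      using hol' ball_subset_cball by (rule holomorphic_on_subset)
    show "norm (f (x + z *s v)) \<le> B" if "norm (0 - z) = \<rho>" for z
      using that by (intro B in_ball) simp
  qed (use hol' \<rho> in \<open>auto intro: holomorphic_on_imp_continuous_on\<close>)
  moreover have "deriv (\<lambda>z. f (x + z *s v)) 0 = f' v"
    by (rule DERIV_imp_deriv, rule has_derivative_along_line) (use f' in auto)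
  ultimately show ?thesis by (simp add: \<rho>_def)
qed

lemma holomorphic3_on_diff:
  assumes "holomorphic3_on U f" "holomorphic3_on U g"
  shows "holomorphic3_on U (\<lambda>p. f p - g p)"
  unfolding holomorphic3_on_def
proof
  fix p assume "p \<in> U"
  then obtain f' g' where "(f has_derivative f') (at p)" "\<And>a v. f' (a *s v) = a * f' v"
    "(g has_derivative g') (at p)" "\<And>a v. g' (a *s v) = a * g' v"
    using assms unfolding holomorphic3_on_def by meson
  then show "\<exists>f'. ((\<lambda>p. f p - g p) has_derivative f') (at p) \<and> (\<forall>a v. f' (a *s v) = a * f' v)"
    by (intro exI[of _ "\<lambda>v. f' v - g' v"]) (auto intro: has_derivative_diff simp: right_diff_distrib)
qed

text \<open>
  Applied to differences \<open>F n - F m\<close>, the directional Cauchy estimate turns uniform convergence of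
  functions into uniform convergence of their Frechet derivatives on a smaller ball. A limit
  under these conditions is differentiable, and complex linearity passes to the limit derivative.
\<close>

lemma holomorphic3_uniform_limit:
  fixes F :: "nat \<Rightarrow> complex ^ 3 \<Rightarrow> complex"
  assumes "open U" and hol: "\<And>n. holomorphic3_on U (F n)"
    and lim: "uniform_limit U F g sequentially"
  shows "holomorphic3_on U g"
  unfolding holomorphic3_on_def
proof
  fix p assume "p \<in> U"
  obtain R where R: "R > 0" "cball p R \<subseteq> U"
    using \<open>open U\<close> \<open>p \<in> U\<close> open_contains_cball by blast
  define r where "r = R / 2"
  define S where "S = ball p r"
  have r: "r > 0" using R by (simp add: r_def)
  have near: "cball x r \<subseteq> U" if "x \<in> S" for x
  proof
    fix y assume "y \<in> cball x r"
    then have "dist p y \<le> R"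
      using that dist_triangle[of p y x] by (simp add: S_def r_def)
    then show "y \<in> U" using R(2) by auto
  qed
  have SU: "S \<subseteq> U" using near r by fastforce
  have "\<forall>n. \<forall>x\<in>U. \<exists>D. (F n has_derivative D) (at x) \<and> (\<forall>c v. D (c *s v) = c * D v)"
    using hol unfolding holomorphic3_on_def by blast
  then obtain F' where F': "\<And>n x. x \<in> U \<Longrightarrow> (F n has_derivative F' n x) (at x)"
      "\<And>n x c v. x \<in> U \<Longrightarrow> F' n x (c *s v) = c * F' n x v"
    by metis
  have cauchy: "\<exists>N. \<forall>m\<ge>N. \<forall>n\<ge>N. \<forall>x\<in>S. \<forall>v. norm (F' n x v - F' m x v) \<le> e * norm v"
    if "e > 0" for e
  proof -
    have "uniformly_Cauchy_on U F"
      using lim uniformly_convergent_Cauchy unfolding uniformly_convergent_on_def by blast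
    then obtain N where N: "\<And>y m n. y \<in> U \<Longrightarrow> m \<ge> N \<Longrightarrow> n \<ge> N \<Longrightarrow> dist (F n y) (F m y) < e * r"
      unfolding uniformly_Cauchy_on_def using mult_pos_pos[OF \<open>e > 0\<close> r] by blast
    have "norm (F' n x v - F' m x v) \<le> e * norm v" if "m \<ge> N" "n \<ge> N" "x \<in> S" for m n x v
    proof -
      have "norm ((\<lambda>v. F' n x v - F' m x v) v) \<le> (e * r) / r * norm v"
        using that near[OF that(3)] SU N
        by (intro directional_Cauchy_estimate[OF holomorphic3_on_diff[OF hol[of n] hol[of m]] r])
           (auto intro!: has_derivative_diff F' less_imp_le simp: F' right_diff_distrib dist_norm subset_iff)
      then show ?thesis using r by simp
    qed
    then show ?thesis by blast
  qed
  define G where "G x v = lim (\<lambda>n. F' n x v)" for x v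
  have G: "(\<lambda>n. F' n x v) \<longlonglongrightarrow> G x v" if "x \<in> S" for x v
  proof -
    have "Cauchy (\<lambda>n. F' n x v)"
    proof (rule metric_CauchyI)
      fix e :: real assume "e > 0"
      define d where "d = e / (norm v + 1)"
      have d: "d > 0" "d * norm v < e"
        using \<open>e > 0\<close> norm_ge_zero[of v] by (auto simp: d_def field_simps add_pos_nonneg)
      show "\<exists>N. \<forall>m\<ge>N. \<forall>n\<ge>N. dist (F' m x v) (F' n x v) < e"
        using cauchy[OF d(1)] d(2) that unfolding dist_norm by (meson order_le_less_trans)
    qed
    then show ?thesis
      unfolding G_def using Cauchy_convergent convergent_LIMSEQ_iff by blast
  qed
  have "\<exists>g. \<forall>x\<in>S. (\<lambda>n. F n x) \<longlonglongrightarrow> g x \<and> (g has_derivative G x) (at x within S)"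
  proof (rule has_derivative_sequence)
    show "convex S" by (simp add: S_def)
    show "p \<in> S" using r by (simp add: S_def)
    show "(\<lambda>n. F n p) \<longlonglongrightarrow> g p" using lim \<open>p \<in> U\<close> by (rule tendsto_uniform_limitI)
    show "(F n has_derivative F' n x) (at x within S)" if "x \<in> S" for n x
      using F'(1) that SU by (blast intro: has_derivative_at_withinI)
    fix e :: real assume "e > 0"
    then obtain N where N: "\<And>m n x v. m \<ge> N \<Longrightarrow> n \<ge> N \<Longrightarrow> x \<in> S \<Longrightarrow> norm (F' n x v - F' m x v) \<le> e * norm v"
      using cauchy by blast
    have "norm (F' n x v - G x v) \<le> e * norm v" if "n \<ge> N" "x \<in> S" for n x v
    proof (rule tendsto_upperbound)
      show "(\<lambda>m. norm (F' n x v - F' m x v)) \<longlonglongrightarrow> norm (F' n x v - G x v)"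
        by (intro tendsto_intros G that)
      show "\<forall>\<^sub>F m in sequentially. norm (F' n x v - F' m x v) \<le> e * norm v"
        using N[OF _ that] unfolding eventually_sequentially by blast
    qed simp
    then show "\<forall>\<^sub>F n in sequentially. \<forall>x\<in>S. \<forall>v. norm (F' n x v - G x v) \<le> e * norm v"
      unfolding eventually_sequentially by blast
  qed
  then obtain g2 where g2: "\<And>x. x \<in> S \<Longrightarrow> (\<lambda>n. F n x) \<longlonglongrightarrow> g2 x"
      "\<And>x. x \<in> S \<Longrightarrow> (g2 has_derivative G x) (at x within S)" by blast
  have S: "open S" "p \<in> S" using r by (auto simp: S_def)
  have "g2 x = g x" if "x \<in> S" for x
    using g2(1)[OF that] tendsto_uniform_limitI[OF lim] SU that LIMSEQ_unique by blast
  moreover have "(g2 has_derivative G p) (at p)"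
    using g2(2)[OF S(2)] at_within_open[OF S(2,1)] by simp
  ultimately have "(g has_derivative G p) (at p)"
    using has_derivative_transform_within_open[OF _ S] by blast
  moreover have "G p (c *s v) = c * G p v" for c v
  proof (rule LIMSEQ_unique[OF G[OF S(2)]])
    show "(\<lambda>n. F' n p (c *s v)) \<longlonglongrightarrow> c * G p v"
      using tendsto_mult_left[OF G[OF S(2)]] F'(2)[OF \<open>p \<in> U\<close>] by simp
  qed
  ultimately show "\<exists>g'. (g has_derivative g') (at p) \<and> (\<forall>c v. g' (c *s v) = c * g' v)" by blast
qed

text \<open>
  Taylor's formula of order one, with the second derivative bounded by the Cauchy inequality on discs
  of radius \<open>r\<close> around points of the disc of radius \<open>r\<close>. The bound on the right depends on
  \<open>\<phi>\<close> only through \<open>B\<close>, which makes the convergence of difference quotients uniform.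
\<close>

lemma difference_quotient_estimate:
  assumes hol: "\<phi> holomorphic_on ball 0 (2 * r)" and r: "r > 0"
    and B: "\<And>z. norm z < 2 * r \<Longrightarrow> norm (\<phi> z) \<le> B"
    and s: "norm s < r" "s \<noteq> 0"
  shows "norm ((\<phi> s - \<phi> 0) / s - deriv \<phi> 0) \<le> 2 * B / r\<^sup>2 * norm s"
proof -
  have bound: "norm ((deriv ^^ Suc 1) \<phi> w) \<le> 2 * B / r\<^sup>2" if w: "w \<in> ball 0 r" for w
  proof -
    have sub: "cball w r \<subseteq> ball 0 (2 * r)"
      using w by (intro cball_subset_ball_iff[THEN iffD2]) (auto simp: dist_commute)
    have "norm ((deriv ^^ 2) \<phi> w) \<le> fact 2 * B / r ^ 2"
    proof (rule Cauchy_inequality)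
      show "\<phi> holomorphic_on ball w r"
        using hol sub ball_subset_cball by (meson holomorphic_on_subset)
      show "continuous_on (cball w r) \<phi>"
        using hol sub by (meson holomorphic_on_subset holomorphic_on_imp_continuous_on)
      show "norm (\<phi> z) \<le> B" if "norm (w - z) = r" for z
      proof (rule B)
        have "z \<in> cball w r" using that by (simp add: dist_norm)
        then show "norm z < 2 * r" using sub by auto
      qed
    qed (rule r)
    then show ?thesis by (simp add: numeral_2_eq_2)
  qed
  have "norm ((deriv ^^ 0) \<phi> s - (\<Sum>i\<le>1. (deriv ^^ i) \<phi> 0 * (s - 0) ^ i / fact i))
      \<le> 2 * B / r\<^sup>2 * norm (s - 0) ^ Suc 1 / fact 1"
  proof (rule complex_Taylor[where S = "ball 0 r"])
    fix i x assume x: "x \<in> ball (0::complex) r"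
    have "(deriv ^^ i) \<phi> holomorphic_on ball 0 (2 * r)"
      using hol by (rule holomorphic_higher_deriv) simp
    then have "((deriv ^^ i) \<phi> has_field_derivative deriv ((deriv ^^ i) \<phi>) x) (at x)"
      using x r by (intro holomorphic_derivI[of _ "ball 0 (2 * r)"]) auto
    then show "((deriv ^^ i) \<phi> has_field_derivative (deriv ^^ Suc i) \<phi> x) (at x within ball 0 r)"
      by (simp add: has_field_derivative_at_within)
  qed (use bound r s in auto)
  then have "norm (\<phi> s - \<phi> 0 - s * deriv \<phi> 0) \<le> 2 * B / r\<^sup>2 * norm s * norm s"
    by (simp add: algebra_simps power2_eq_square)
  moreover have "(\<phi> s - \<phi> 0) / s - deriv \<phi> 0 = (\<phi> s - \<phi> 0 - s * deriv \<phi> 0) / s"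
    using s by (simp add: field_simps)
  ultimately show ?thesis
    using s by (simp add: norm_divide divide_le_eq)
qed

text \<open>
  Holomorphy in several variables is defined by one Frechet derivative, without continuity of that
  derivative, so the regularity of partial derivatives needs an argument: difference quotients in
  the direction \<open>e\<^sub>i\<close> are holomorphic and converge locally uniformly to \<open>\<partial>\<^sub>i f\<close>.
\<close>

lemma holomorphic3_on_pd:
  assumes "open U" and hol: "holomorphic3_on U f"
  shows "holomorphic3_on U (pd i f)"
  unfolding holomorphic3_on_iff
proof
  fix p assume "p \<in> U"
  let ?e = "axis i (1::complex) :: complex ^ 3"
  obtain R where R: "R > 0" "cball p R \<subseteq> U"
    using \<open>open U\<close> \<open>p \<in> U\<close> open_contains_cball by blast
  \<comment> \<open>Base points range over a ball of radius \<open>r\<close> and increments over a disc of radius \<open>2 r\<close>.\<close>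
  define r where "r = R / 3"
  have r: "r > 0" using R by (simp add: r_def)
  have inside: "q + s *s ?e \<in> cball p R" if "q \<in> ball p r" "norm s < 2 * r" for q s
    using that norm_triangle_ineq[of "q - p" "s *s ?e"]
    by (simp add: r_def dist_norm norm_minus_commute norm_vector_smult norm_axis_one algebra_simps)
  have "continuous_on (cball p R) f"
    using hol R(2) unfolding holomorphic3_on_def
    by (meson continuous_at_imp_continuous_on has_derivative_continuous subsetD)
  then have "bounded (f ` cball p R)"
    by (intro compact_imp_bounded compact_continuous_image compact_cball)
  then obtain B where B: "\<And>q. q \<in> cball p R \<Longrightarrow> norm (f q) \<le> B"
    unfolding bounded_iff by blast
  \<comment> \<open>The shift by \<open>2\<close> keeps every increment strictly below \<open>r\<close>.\<close>
  define s where "s n = complex_of_real (r / real (n + 2))" for n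
  have s: "norm (s n) < r" "s n \<noteq> 0" for n
    using r by (auto simp: s_def norm_divide divide_less_eq simp flip: of_real_add)
  define F where "F n q = (1 / s n) * (f (q + s n *s ?e) - f q)" for n q
  have est: "norm (F n q - pd i f q) \<le> 2 * B / r\<^sup>2 * norm (s n)" if q: "q \<in> ball p r" for n q
  proof -
    have "norm ((f (q + s n *s ?e) - f (q + 0 *s ?e)) / s n - deriv (\<lambda>z. f (q + z *s ?e)) 0)
        \<le> 2 * B / r\<^sup>2 * norm (s n)"
    proof (rule difference_quotient_estimate[OF _ r _ s])
      have "(\<lambda>z. f (q + z *s ?e)) field_differentiable (at z)" if "z \<in> ball 0 (2 * r)" for z
      proof -
        have "q + z *s ?e \<in> U" using inside[OF q] that R(2) by auto
        then show ?thesis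
          using hol has_derivative_along_line
          unfolding holomorphic3_on_def field_differentiable_def by blast
      qed
      then show "(\<lambda>z. f (q + z *s ?e)) holomorphic_on ball 0 (2 * r)"
        unfolding holomorphic_on_def using field_differentiable_at_within by blast
    qed (intro B inside q)
    then show ?thesis by (simp add: F_def pd_def)
  qed
  have "holomorphic3_on (ball p r) (pd i f)"
  proof (rule holomorphic3_uniform_limit)
    have shift: "holomorphic3_on (ball p r) (\<lambda>q. f (q + a *s ?e))" if "norm a < 2 * r" for a
      unfolding holomorphic3_on_def
    proof
      fix q assume "q \<in> ball p r"
      then have "q + a *s ?e \<in> U" using inside that R(2) by blast
      then obtain f' where f': "(f has_derivative f') (at (q + a *s ?e))" "\<And>c v. f' (c *s v) = c * f' v"
        using hol unfolding holomorphic3_on_def by blast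
      have "((\<lambda>q. q + a *s ?e) has_derivative (\<lambda>v. v)) (at q)"
        by (auto intro!: derivative_eq_intros)
      from has_derivative_compose[OF this f'(1)] f'(2)
      show "\<exists>f'. ((\<lambda>q. f (q + a *s ?e)) has_derivative f') (at q) \<and> (\<forall>c v. f' (c *s v) = c * f' v)"
        by blast
    qed
    show "holomorphic3_on (ball p r) (F n)" for n
      unfolding F_def using shift[of "s n"] shift[of 0] s[of n] r
      by (intro holomorphic3_on_cmult holomorphic3_on_diff) auto
    have "(\<lambda>n. 2 * B / r\<^sup>2 * norm (s n)) \<longlonglongrightarrow> 2 * B / r\<^sup>2 * 0"
    proof (intro tendsto_intros)
      have "(\<lambda>n. r / real (n + 2)) \<longlonglongrightarrow> 0"
        using LIMSEQ_ignore_initial_segment[OF lim_const_over_n, of r 2] by simp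
      moreover have "norm (s n) = r / real (n + 2)" for n using r by (simp add: s_def norm_divide flip: of_real_add)
      ultimately show "(\<lambda>n. norm (s n)) \<longlonglongrightarrow> 0" by simp
    qed
    then have small: "(\<lambda>n. 2 * B / r\<^sup>2 * norm (s n)) \<longlonglongrightarrow> 0" by simp
    show "uniform_limit (ball p r) F (pd i f) sequentially"
    proof (rule uniform_limitI)
      fix e :: real assume "e > 0"
      with small have "\<forall>\<^sub>F n in sequentially. 2 * B / r\<^sup>2 * norm (s n) < e"
        by (rule order_tendstoD)
      then show "\<forall>\<^sub>F n in sequentially. \<forall>q\<in>ball p r. dist (F n q) (pd i f q) < e"
        unfolding dist_norm by (rule eventually_mono) (blast intro: order_le_less_trans est)
    qed
  qed simp
  then show "scalar_differentiable (pd i f) p"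
    using r by (simp add: holomorphic3_on_iff)
qed

section \<open>Solutions of the dKP equation give Einstein-Weyl structures\<close>

theorem proposition2p1:
  shows "(\<forall>(U :: (real ^ 3) set) (u :: real ^ 3 \<Rightarrow> real).
            open U \<longrightarrow> smooth3_on U u \<longrightarrow> dKP U u \<longrightarrow>
              einstein_weyl smooth3_on U (dKP_metric u) (dKP_form u)
              \<and> einstein_weyl_equation U (dKP_metric u) (dKP_form u))
       \<and> (\<forall>(U :: (complex ^ 3) set) (u :: complex ^ 3 \<Rightarrow> complex).
            open U \<longrightarrow> holomorphic3_on U u \<longrightarrow> dKP U u \<longrightarrow>
              einstein_weyl holomorphic3_on U (dKP_metric u) (dKP_form u)
              \<and> einstein_weyl_equation U (dKP_metric u) (dKP_form u))"
proof (intro conjI allI impI)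
  fix U :: "(real ^ 3) set" and u :: "real ^ 3 \<Rightarrow> real"
  assume "open U" and u: "smooth3_on U u" and "dKP U u"
  then interpret dKP_solution U u
    by unfold_locales (auto intro: smooth3_on_scalar_differentiable smooth3_on_pd)
  show "einstein_weyl smooth3_on U (dKP_metric u) (dKP_form u)"
    by (intro einstein_weyl_dKP weyl_pair_dKP open_U smooth3_on_const smooth3_on_cmult smooth3_on_pd u)
  show "einstein_weyl_equation U (dKP_metric u) (dKP_form u)"
    by (rule einstein_weyl_equation_dKP)
next
  fix U :: "(complex ^ 3) set" and u :: "complex ^ 3 \<Rightarrow> complex"
  assume "open U" and u: "holomorphic3_on U u" and "dKP U u"
  moreover have pd: "holomorphic3_on U (pd i u)" for i
    using \<open>open U\<close> u by (rule holomorphic3_on_pd)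
  ultimately interpret dKP_solution U u
    by unfold_locales (auto simp: holomorphic3_on_iff)
  show "einstein_weyl holomorphic3_on U (dKP_metric u) (dKP_form u)"
    by (intro einstein_weyl_dKP weyl_pair_dKP open_U holomorphic3_on_const holomorphic3_on_cmult u pd)
  show "einstein_weyl_equation U (dKP_metric u) (dKP_form u)"
    by (rule einstein_weyl_equation_dKP)
qed

end
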